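(* According to relative interval analysis, $l(\mathrm{Nai},\mathrm{Maj})=[-\frac14,\frac14]$, i.e., $\mathrm{Min}(\mathrm{Nai},\mathrm{Maj})=-\frac14$ and $\mathrm{Max}(\mathrm{Nai},\mathrm{Maj})=\frac14$.
   Context: Online frequent items problem: an input sequence is $I=a_1,\ldots,a_n$ of items from an infinite universe, $n=|I|$. An algorithm maintains a buffer holding one item; $s_t$ is the buffer content after step $t$; at step $1$ the buffer receives $a_1$, and at each later step $t$ the algorithm either keeps $s_{t-1}$ or replaces it by $a_t$. With $f_I(a)=|\{i:a_i=a\}|/n$, the aggregate frequency of $\mathcal A$ on $I$ is $\mathcal A(I)=\sum_{t=1}^n f_I(s^{\mathcal A}_t)$. Nai sets $s_t=a_t$ for all $t$. Maj keeps a counter, initially $0$: when an item arrives, if the counter is $0$ it buffers the item and sets the counter to $1$; otherwise, if the arriving item equals the buffered item the counter is incremented, else it is decremented (buffer unchanged). Relative interval analysis: $\mathrm{Min}_{\mathcal A,\mathcal B}(n)=\min_{|I|=n}\{\mathcal A(I)-\mathcal B(I)\}$, $\mathrm{Max}_{\mathcal A,\mathcal B}(n)=\max_{|I|=n}\{\mathcal A(I)-\mathcal B(I)\}$, $\mathrm{Min}(\mathcal A,\mathcal B)=\liminf_{n\to\infty}\mathrm{Min}_{\mathcal A,\mathcal B}(n)/n$, $\mathrm{Max}(\mathcal A,\mathcal B)=\limsup_{n\to\infty}\mathrm{Max}_{\mathcal A,\mathcal B}(n)/n$, and $l(\mathcal A,\mathcal B)=[\mathrm{Min}(\mathcal A,\mathcal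 B),\mathrm{Max}(\mathcal A,\mathcal B)]$. *)

theory Defs
  imports Complex_Main "HOL-Library.Extended_Real" "HOL-Library.Liminf_Limsup"
begin

text \<open>An algorithm is represented by the function mapping each nonempty sequence of items
  to the content of its one-item buffer after processing that sequence. Hence the content
  after step \<open>t\<close> on input \<open>I\<close> is \<open>A (take t I)\<close>; values at the empty sequence play no role.\<close>

type_synonym 'a alg = "'a list \<Rightarrow> 'a"

definition online :: "'a alg \<Rightarrow> bool" where
  "online A \<longleftrightarrow> (\<forall>a. A [a] = a) \<and> (\<forall>I a. I \<noteq> [] \<longrightarrow> A (I @ [a]) \<in> {A I, a})"

definition freq :: "'a list \<Rightarrow> 'a \<Rightarrow> real" where
  "freq I a = real (count_list I a) / real (length I)"

definition aggregate :: "'a alg \<Rightarrow> 'a list \<Rightarrow> real" where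
  "aggregate A I = (\<Sum>t = 1..length I. freq I (A (take t I)))"

definition nai :: "'a alg" where
  "nai I = last I"

text \<open>The state of Maj consists of the buffer (\<open>None\<close> before the first item) and the counter.\<close>

fun maj_step :: "'a option \<times> nat \<Rightarrow> 'a \<Rightarrow> 'a option \<times> nat" where
  "maj_step (s, c) a =
     (if c = 0 then (Some a, 1)
      else if s = Some a then (s, c + 1)
      else (s, c - 1))"

definition maj_state :: "'a list \<Rightarrow> 'a option \<times> nat" where
  "maj_state I = foldl maj_step (None, 0) I"

definition maj :: "'a alg" where
  "maj I = the (fst (maj_state I))"

text \<open>The set of differences is finite even though there are infinitely many inputs of
  length \<open>n\<close> (see \<open>finite_differences\<close> below), so \<open>Min\<close> and \<open>Max\<close> are meaningful.\<close>

definition differences :: "'a alg \<Rightarrow> 'a alg \<Rightarrow> nat \<Rightarrow> real set" where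
  "differences A B n = {aggregate A I - aggregate B I | I. length I = n}"

definition Min_diff :: "'a alg \<Rightarrow> 'a alg \<Rightarrow> nat \<Rightarrow> real" where
  "Min_diff A B n = Min (differences A B n)"

definition Max_diff :: "'a alg \<Rightarrow> 'a alg \<Rightarrow> nat \<Rightarrow> real" where
  "Max_diff A B n = Max (differences A B n)"

definition Min_rel :: "'a alg \<Rightarrow> 'a alg \<Rightarrow> ereal" where
  "Min_rel A B = liminf (\<lambda>n. ereal (Min_diff A B n / real n))"

definition Max_rel :: "'a alg \<Rightarrow> 'a alg \<Rightarrow> ereal" where
  "Max_rel A B = limsup (\<lambda>n. ereal (Max_diff A B n / real n))"

definition rel_interval :: "'a alg \<Rightarrow> 'a alg \<Rightarrow> ereal set" where
  "rel_interval A B = {Min_rel A B .. Max_rel A B}"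

lemma aggregate_eq:
  "aggregate A I = real (\<Sum>t = 1..length I. count_list I (A (take t I))) / real (length I)"
  by (simp add: aggregate_def freq_def sum_divide_distrib)

lemma finite_differences: "finite (differences A B n)"
proof -
  have bound: "(\<Sum>t = 1..length I. count_list I (C (take t I))) \<in> {..n * n}"
    if "length I = n" for I :: "'a list" and C :: "'a alg"
  proof -
    have "(\<Sum>t = 1..length I. count_list I (C (take t I))) \<le> (\<Sum>t = 1..length I. length I)"
      by (intro sum_mono count_le_length)
    then show ?thesis using that by simp
  qed
  have "differences A B n \<subseteq>
      (\<lambda>(k, l). real k / real n - real l / real n) ` ({..n * n} \<times> {..n * n})"
  proof
    fix x assume "x \<in> differences A B n"
    then obtain I where I: "length I = n" "x = aggregate A I - aggregate B I"
      unfolding differences_def by blast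
    show "x \<in> (\<lambda>(k, l). real k / real n - real l / real n) ` ({..n * n} \<times> {..n * n})"
      by (rule image_eqI[where x = "(\<Sum>t = 1..length I. count_list I (A (take t I)),
            \<Sum>t = 1..length I. count_list I (B (take t I)))"])
        (use I bound[OF I(1), of A] bound[OF I(1), of B] in \<open>simp_all add: aggregate_eq\<close>)
  qed
  then show ?thesis by (rule finite_subset) simp
qed

lemma differences_nonempty: "differences A B n \<noteq> {}"
proof -
  have "aggregate A (replicate n undefined) - aggregate B (replicate n undefined)
      \<in> differences A B n"
    unfolding differences_def by (rule CollectI, rule exI[where x = "replicate n undefined"]) simp
  then show ?thesis by blast
qed

lemma online_nai: "online nai"
  by (simp add: online_def nai_def)

lemma maj_state_snoc: "maj_state (I @ [a]) = maj_step (maj_state I) a"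
  by (simp add: maj_state_def)

lemma online_maj: "online maj"
  unfolding online_def
proof (intro conjI allI impI)
  fix a :: 'a show "maj [a] = a" by (simp add: maj_def maj_state_def)
next
  fix I and a :: 'a
  show "maj (I @ [a]) \<in> {maj I, a}"
    by (cases "maj_state I") (simp add: maj_def maj_state_snoc)
qed

end

theory Submission imports Defs begin

text \<open>Write \<open>n\<^sub>x\<close> for the number of occurrences of \<open>x\<close> and \<open>T\<^sub>x\<close> for the number of steps at which
  \<open>x\<close> is buffered, so that \<open>n\<close> times the difference is \<open>\<Sum>x. n\<^sub>x (n\<^sub>x - T\<^sub>x)\<close>. If \<open>M\<close> is the largest
  multiplicity, then \<open>\<Sum>x. n\<^sub>x\<^sup>2 \<ge> M\<^sup>2\<close> and \<open>\<Sum>x. n\<^sub>x T\<^sub>x \<le> n M\<close>, and \<open>n M - M\<^sup>2 \<le> n\<^sup>2 / 4\<close>; this gives the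
  lower bound for every algorithm in place of Maj. For Maj one has \<open>T\<^sub>x \<le> 2 n\<^sub>x\<close>, hence
  \<open>y\<^sub>x = n\<^sub>x - T\<^sub>x / 2\<close> is nonnegative with total \<open>n / 2\<close>, and
  \<open>\<Sum>x. n\<^sub>x (n\<^sub>x - T\<^sub>x) = \<Sum>x. (y\<^sub>x\<^sup>2 - T\<^sub>x\<^sup>2 / 4) \<le> (\<Sum>x. y\<^sub>x)\<^sup>2 = n\<^sup>2 / 4\<close>. With distinct items \<open>b\<^sub>i\<close>, both
  bounds are attained in the limit, by \<open>b\<^sub>1, a, b\<^sub>2, a, \<dots>\<close> (Maj always buffers some \<open>b\<^sub>i\<close>) and
  \<open>a, b\<^sub>1, a, b\<^sub>2, \<dots>\<close> (Maj always buffers \<open>a\<close>).\<close>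

section \<open>Buffer contents as a list, and sums grouped by item\<close>

definition buffers :: "'a alg \<Rightarrow> 'a list \<Rightarrow> 'a list" where
  "buffers A I = map (\<lambda>t. A (take t I)) [1..<Suc (length I)]"

lemma buffers_Nil [simp]: "buffers A [] = []"
  by (simp add: buffers_def)

text \<open>The proper prefixes do not see the appended item; this allows induction from the right,
  in step with \<open>maj_state_snoc\<close>.\<close>

lemma buffers_snoc [simp]: "buffers A (I @ [x]) = buffers A I @ [A (I @ [x])]"
  by (auto simp: buffers_def intro: map_cong)

lemma length_buffers [simp]: "length (buffers A I) = length I"
  by (simp add: buffers_def del: upt_Suc)

lemma buffers_nai [simp]: "buffers nai I = I"
  by (induction I rule: rev_induct) (simp_all add: nai_def)

lemma aggregate_buffers:
  "aggregate A I = (\<Sum>x\<leftarrow>buffers A I. real (count_list I x)) / real (length I)"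
proof -
  have "(\<Sum>x\<leftarrow>buffers A I. real (count_list I x))
      = (\<Sum>t = 1..length I. real (count_list I (A (take t I))))"
    unfolding buffers_def
    by (simp add: comp_def interv_sum_list_conv_sum_set_nat atLeastLessThanSuc_atLeastAtMost
        del: upt_Suc)
  then show ?thesis by (simp add: aggregate_eq)
qed

text \<open>Allowing \<open>X\<close> to exceed \<open>set xs\<close> lets the input and the buffer
  list be summed over the same index set \<open>set I\<close>.\<close>

lemma sum_list_map_eq_sum_count_real:
  fixes f :: "'a \<Rightarrow> real"
  assumes "set xs \<subseteq> X" "finite X"
  shows "(\<Sum>x\<leftarrow>xs. f x) = (\<Sum>x\<in>X. real (count_list xs x) * f x)"
  using assms
proof (induction xs)
  case (Cons a xs)
  have "(\<Sum>x\<in>X. real (count_list (a # xs) x) * f x)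
      = (\<Sum>x\<in>X. real (count_list xs x) * f x + (if a = x then f x else 0))"
    by (intro sum.cong) (auto simp: algebra_simps)
  then show ?case using Cons by (simp add: sum.distrib)
qed simp

text \<open>Each value is at most the total, so one factor of each square can be replaced by the
  total.\<close>

lemma sum_squares_le_square_sum:
  fixes f :: "'a \<Rightarrow> real"
  assumes "finite X" "\<And>x. x \<in> X \<Longrightarrow> 0 \<le> f x"
  shows "(\<Sum>x\<in>X. (f x)\<^sup>2) \<le> (\<Sum>x\<in>X. f x)\<^sup>2"
proof -
  have "(\<Sum>x\<in>X. (f x)\<^sup>2) \<le> (\<Sum>x\<in>X. f x * (\<Sum>x\<in>X. f x))"
    using assms by (intro sum_mono) (auto simp: power2_eq_square intro!: mult_left_mono member_le_sum)
  then show ?thesis by (simp add: power2_eq_square sum_distrib_right)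
qed

lemma fst_maj_state: "I \<noteq> [] \<Longrightarrow> fst (maj_state I) = Some (maj I)"
proof (induction I rule: rev_induct)
  case (snoc x I)
  then show ?case
    by (cases "I = []"; cases "maj_state I") (auto simp: maj_def maj_state_snoc maj_state_def)
qed simp

text \<open>The counter term makes the bound inductive: copies of the buffered item that have not been
  cancelled pay for the future steps at which that item remains buffered.\<close>

lemma count_buffers_maj_potential:
  "count_list (buffers maj I) x + (if fst (maj_state I) = Some x then snd (maj_state I) else 0)
    \<le> 2 * count_list I x"
proof (induction I rule: rev_induct)
  case Nil
  then show ?case by (simp add: maj_state_def)
next
  case (snoc a I)
  have "fst (maj_state (I @ [a])) = Some (maj (I @ [a]))"
    by (simp add: fst_maj_state)
  then show ?case using snoc
    by (cases "maj_state I") (auto simp: maj_state_snoc split: if_splits)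
qed

lemma count_buffers_maj: "count_list (buffers maj I) x \<le> 2 * count_list I x"
  using count_buffers_maj_potential[of I x] by simp

section \<open>Bounds valid for every input\<close>

lemma nai_diff_lower: "aggregate nai I - aggregate A I \<ge> - real (length I) / 4"
proof (cases "I = []")
  case True
  then show ?thesis by (simp add: aggregate_eq)
next
  case False
  define n where "n = real (length I)"
  define M where "M = Max (count_list I ` set I)"
  have n: "n > 0" using False by (simp add: n_def)
  have "M \<in> count_list I ` set I" using False unfolding M_def by (intro Max_in) auto
  then obtain m where m: "m \<in> set I" "count_list I m = M" by auto
  have M: "count_list I x \<le> M" for x
    by (cases "x \<in> set I") (auto simp: M_def count_list_0_iff)
  have "(\<Sum>x\<leftarrow>buffers A I. real (count_list I x)) \<le> (\<Sum>x\<leftarrow>buffers A I. real M)"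
    by (intro sum_list_mono) (simp add: M)
  then have A: "(\<Sum>x\<leftarrow>buffers A I. real (count_list I x)) \<le> n * M"
    by (simp add: sum_list_triv n_def)
  \<comment> \<open>Only the summand of the most frequent item \<open>m\<close> is kept.\<close>
  have "real M * real M \<le> (\<Sum>x\<in>set I. real (count_list I x) * real (count_list I x))"
    using m by (intro member_le_sum[of m, THEN order_trans[rotated]]) auto
  then have "real M * real M \<le> (\<Sum>x\<leftarrow>buffers nai I. real (count_list I x))"
    by (simp add: sum_list_map_eq_sum_count_real[OF order_refl])
  then have "aggregate nai I - aggregate A I \<ge> (real M * real M - n * M) / n"
    using A n by (simp add: aggregate_buffers n_def[symmetric] diff_divide_distrib[symmetric]
        divide_right_mono)
  moreover have "real M * real M - n * M \<ge> - (n * n) / 4"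
    using zero_le_square[of "real M - n / 2"] by (simp add: algebra_simps)
  then have "(real M * real M - n * M) / n \<ge> - n / 4"
    using n by (simp add: field_simps)
  ultimately show ?thesis unfolding n_def by linarith
qed

lemma nai_maj_diff_upper: "aggregate nai I - aggregate maj I \<le> real (length I) / 4"
proof (cases "I = []")
  case True
  then show ?thesis by (simp add: aggregate_eq)
next
  case False
  define n where "n = real (length I)"
  define c where "c x = real (count_list I x)" for x
  define T where "T x = real (count_list (buffers maj I) x)" for x
  have n: "n > 0" using False by (simp add: n_def)
  \<comment> \<open>By \<open>count_buffers_maj\<close>, an item with no occurrence in
    \<open>I\<close> is never buffered.\<close>
  have sub: "set (buffers maj I) \<subseteq> set I"
  proof
    fix x assume "x \<in> set (buffers maj I)"
    then show "x \<in> set I" using count_buffers_maj[of I x] by (metis count_list_0_iff le_zero_eq mult_0_right)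
  qed
  have T: "T x \<le> 2 * c x" for x
    using count_buffers_maj[of I x] unfolding T_def c_def by linarith
  have sum_c: "(\<Sum>x\<in>set I. c x) = n"
    by (simp add: c_def n_def of_nat_sum[symmetric] sum_count_set del: of_nat_sum)
  have sum_T: "(\<Sum>x\<in>set I. T x) = n"
    by (simp add: T_def n_def of_nat_sum[symmetric] sum_count_set sub del: of_nat_sum)
  have "n * (aggregate nai I - aggregate maj I)
      = (\<Sum>x\<in>set I. c x * c x) - (\<Sum>x\<in>set I. T x * c x)"
    using n by (simp add: aggregate_buffers sum_list_map_eq_sum_count_real[OF sub finite_set]
        sum_list_map_eq_sum_count_real[OF order_refl] n_def c_def T_def right_diff_distrib)
  also have "\<dots> = (\<Sum>x\<in>set I. (c x - T x / 2)\<^sup>2 - (T x / 2)\<^sup>2)"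
    by (simp add: sum_subtractf[symmetric] power2_eq_square algebra_simps)
  also have "\<dots> \<le> (\<Sum>x\<in>set I. (c x - T x / 2)\<^sup>2)"
    by (intro sum_mono) simp
  also have "\<dots> \<le> (\<Sum>x\<in>set I. c x - T x / 2)\<^sup>2"
    using T by (intro sum_squares_le_square_sum) (auto simp: field_simps)
  also have "(\<Sum>x\<in>set I. c x - T x / 2) = n / 2"
    by (simp add: sum_subtractf sum_divide_distrib[symmetric] sum_c sum_T)
  finally have "n * (aggregate nai I - aggregate maj I) \<le> n * (n / 4)"
    by (simp add: power2_eq_square)
  then show ?thesis
    using n by (simp add: n_def[symmetric])
qed

lemma Min_nai_maj_lower: "- 1 / 4 \<le> Min_diff (nai :: 'a alg) maj n / real n"
proof -
  have "Min_diff (nai :: 'a alg) maj n \<in> differences (nai :: 'a alg) maj n"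
    unfolding Min_diff_def by (rule Min_in[OF finite_differences differences_nonempty])
  then have "- real n / 4 \<le> Min_diff (nai :: 'a alg) maj n"
    using nai_diff_lower by (fastforce simp: differences_def)
  \<comment> \<open>For \<open>n = 0\<close> the quotient is \<open>0\<close> by convention, and the
    bound still holds.\<close>
  then show ?thesis by (cases "n = 0") (simp_all add: field_simps)
qed

lemma Max_nai_maj_upper: "Max_diff (nai :: 'a alg) maj n / real n \<le> 1 / 4"
proof -
  have "Max_diff (nai :: 'a alg) maj n \<in> differences (nai :: 'a alg) maj n"
    unfolding Max_diff_def by (rule Max_in[OF finite_differences differences_nonempty])
  then have "Max_diff (nai :: 'a alg) maj n \<le> real n / 4"
    using nai_maj_diff_upper by (fastforce simp: differences_def)
  then show ?thesis by (cases "n = 0") (simp_all add: field_simps)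
qed

section \<open>Alternating inputs, the extremal examples\<close>

fun alternate :: "(nat \<Rightarrow> 'a) \<Rightarrow> (nat \<Rightarrow> 'a) \<Rightarrow> nat \<Rightarrow> 'a list" where
  "alternate u v 0 = []"
| "alternate u v (Suc k) = (alternate u v k @ [u k]) @ [v k]"

lemma length_alternate [simp]: "length (alternate u v k) = 2 * k"
  by (induction k) simp_all

lemma sum_list_alternate:
  fixes g :: "'a \<Rightarrow> real"
  shows "(\<Sum>x\<leftarrow>alternate u v k. g x) = (\<Sum>i<k. g (u i) + g (v i))"
  by (induction k) simp_all

lemma count_list_alternate:
  "count_list (alternate u v k) x = card {i. i < k \<and> u i = x} + card {i. i < k \<and> v i = x}"
proof (induction k)
  case (Suc k)
  have *: "{i. i < Suc k \<and> w i = x} = {i. i < k \<and> w i = x} \<union> (if w k = x then {k} else {})"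
    for w :: "nat \<Rightarrow> 'a"
    by (auto simp: less_Suc_eq)
  show ?case using Suc by (simp add: *)
qed simp

text \<open>Every pair starts with counter \<open>0\<close>: \<open>u k\<close> enters the buffer,
  and \<open>v k\<close> only cancels it, so \<open>u k\<close> is held for both steps. The
  induction therefore carries the counter along.\<close>

lemma buffers_maj_alternate:
  assumes "\<And>i. u i \<noteq> v i"
  shows "buffers maj (alternate u v k) = alternate u u k"
proof -
  have "buffers maj (alternate u v k) = alternate u u k \<and> snd (maj_state (alternate u v k)) = 0"
  proof (induction k)
    case 0
    then show ?case by (simp add: maj_state_def)
  next
    case (Suc k)
    \<comment> \<open>The two items of a pair stay separate snocs, so that the snoc rules apply
      twice.\<close>
    then show ?case using assms[of k]
      by (cases "maj_state (alternate u v k)")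
        (auto simp: maj_def maj_state_snoc simp del: append_assoc)
  qed
  then show ?thesis ..
qed

text \<open>In each pair one step agrees; at the other, Nai holds \<open>v i\<close> while Maj still
  holds \<open>u i\<close>.\<close>

lemma diff_alternate:
  fixes u v :: "nat \<Rightarrow> 'a" and k :: nat
  defines "I \<equiv> alternate u v k"
  assumes "\<And>i. u i \<noteq> v i"
  shows "aggregate nai I - aggregate maj I
    = (\<Sum>i<k. real (count_list I (v i)) - real (count_list I (u i))) / (2 * real k)"
  unfolding I_def using assms(2)
  by (simp add: aggregate_buffers buffers_maj_alternate sum_list_alternate
      diff_divide_distrib[symmetric] sum_subtractf[symmetric])

lemma count_alternate_const:
  fixes b :: "nat \<Rightarrow> 'a"
  assumes "inj b" "\<And>i. b i \<noteq> a" "i < k"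
  shows "count_list (alternate b (\<lambda>_. a) k) a = k" "count_list (alternate (\<lambda>_. a) b k) a = k"
    "count_list (alternate b (\<lambda>_. a) k) (b i) = 1" "count_list (alternate (\<lambda>_. a) b k) (b i) = 1"
proof -
  have "{j. j < k \<and> b j = b i} = {i}" using assms by (auto dest: injD)
  moreover have "a \<noteq> b i" using assms(2)[of i] by simp
  ultimately show "count_list (alternate b (\<lambda>_. a) k) a = k"
    "count_list (alternate (\<lambda>_. a) b k) a = k"
    "count_list (alternate b (\<lambda>_. a) k) (b i) = 1"
    "count_list (alternate (\<lambda>_. a) b k) (b i) = 1"
    using assms by (simp_all add: count_list_alternate)
qed

lemma infinite_fresh_sequence:
  assumes "infinite (UNIV :: 'a set)"
  shows "\<exists>(a :: 'a) (b :: nat \<Rightarrow> 'a). inj b \<and> (\<forall>i. b i \<noteq> a)"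
proof -
  obtain f :: "nat \<Rightarrow> 'a" where f: "inj f"
    using infinite_countable_subset[OF assms] by auto
  then have "inj (\<lambda>i. f (Suc i)) \<and> (\<forall>i. f (Suc i) \<noteq> f 0)"
    by (auto simp: inj_def)
  then show ?thesis by blast
qed

lemma Max_nai_maj_lower:
  assumes "infinite (UNIV :: 'a set)" "k > 0"
  shows "1 / 4 - 1 / (4 * real k) \<le> Max_diff (nai :: 'a alg) maj (2 * k) / real (2 * k)"
proof -
  obtain a :: 'a and b :: "nat \<Rightarrow> 'a" where ab: "inj b" "\<And>i. b i \<noteq> a"
    using infinite_fresh_sequence[OF assms(1)] by blast
  let ?I = "alternate b (\<lambda>_. a) k"
  \<comment> \<open>Here \<open>a\<close> occurs \<open>k\<close> times and each \<open>b i\<close>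
    with \<open>i < k\<close> once.\<close>
  have "aggregate nai ?I - aggregate maj ?I = (\<Sum>i<k. real k - 1) / (2 * real k)"
    using ab by (subst diff_alternate) (simp_all add: count_alternate_const)
  then have eq: "aggregate nai ?I - aggregate maj ?I = (real k - 1) / 2"
    using assms(2) by simp
  have "aggregate nai ?I - aggregate maj ?I \<in> differences (nai :: 'a alg) maj (2 * k)"
    unfolding differences_def by (rule CollectI, rule exI[of _ ?I]) simp
  then have "aggregate nai ?I - aggregate maj ?I \<le> Max_diff (nai :: 'a alg) maj (2 * k)"
    unfolding Max_diff_def by (intro Max_ge finite_differences)
  then have "(real k - 1) / 2 / real (2 * k) \<le> Max_diff (nai :: 'a alg) maj (2 * k) / real (2 * k)"
    unfolding eq by (intro divide_right_mono) simp_all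
  moreover have "(real k - 1) / 2 / real (2 * k) = 1 / 4 - 1 / (4 * real k)"
    using assms(2) by (simp add: field_simps)
  ultimately show ?thesis by simp
qed

lemma Min_nai_maj_upper:
  assumes "infinite (UNIV :: 'a set)" "k > 0"
  shows "Min_diff (nai :: 'a alg) maj (2 * k) / real (2 * k) \<le> - 1 / 4 + 1 / (4 * real k)"
proof -
  obtain a :: 'a and b :: "nat \<Rightarrow> 'a" where ab: "inj b" "\<And>i. b i \<noteq> a"
    using infinite_fresh_sequence[OF assms(1)] by blast
  let ?I = "alternate (\<lambda>_. a) b k"
  have "aggregate nai ?I - aggregate maj ?I = (\<Sum>i<k. 1 - real k) / (2 * real k)"
    using ab ab(2)[symmetric] by (subst diff_alternate) (simp_all add: count_alternate_const)
  then have eq: "aggregate nai ?I - aggregate maj ?I = (1 - real k) / 2"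
    using assms(2) by simp
  have "aggregate nai ?I - aggregate maj ?I \<in> differences (nai :: 'a alg) maj (2 * k)"
    unfolding differences_def by (rule CollectI, rule exI[of _ ?I]) simp
  then have "Min_diff (nai :: 'a alg) maj (2 * k) \<le> aggregate nai ?I - aggregate maj ?I"
    unfolding Min_diff_def by (intro Min_le finite_differences)
  then have "Min_diff (nai :: 'a alg) maj (2 * k) / real (2 * k) \<le> (1 - real k) / 2 / real (2 * k)"
    unfolding eq by (intro divide_right_mono) simp_all
  moreover have "(1 - real k) / 2 / real (2 * k) = - 1 / 4 + 1 / (4 * real k)"
    using assms(2) by (simp add: field_simps)
  ultimately show ?thesis by simp
qed

section \<open>Passage to the limit\<close>

lemma limsup_ereal_eqI:
  fixes f g :: "nat \<Rightarrow> real"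
  assumes "\<And>n. f n \<le> L" "strict_mono r" "\<And>k. g k \<le> f (r k)" "g \<longlonglongrightarrow> L"
  shows "limsup (\<lambda>n. ereal (f n)) = ereal L"
proof (rule antisym)
  show "limsup (\<lambda>n. ereal (f n)) \<le> ereal L"
    by (intro Limsup_bounded) (simp add: assms)
  \<comment> \<open>A single subsequence reaching \<open>L\<close> suffices, as its limsup cannot
    exceed that of the whole sequence.\<close>
  have "ereal L = limsup (\<lambda>k. ereal (g k))"
    using assms(4) by (intro lim_imp_Limsup[symmetric]) simp_all
  also have "\<dots> \<le> limsup ((\<lambda>n. ereal (f n)) \<circ> r)"
    by (intro Limsup_mono) (simp add: assms)
  also have "\<dots> \<le> limsup (\<lambda>n. ereal (f n))"
    by (rule limsup_subseq_mono) fact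
  finally show "ereal L \<le> limsup (\<lambda>n. ereal (f n))" .
qed

lemma liminf_ereal_eqI:
  fixes f g :: "nat \<Rightarrow> real"
  assumes "\<And>n. L \<le> f n" "strict_mono r" "\<And>k. f (r k) \<le> g k" "g \<longlonglongrightarrow> L"
  shows "liminf (\<lambda>n. ereal (f n)) = ereal L"
proof -
  have "limsup (\<lambda>n. ereal (- f n)) = ereal (- L)"
    using assms by (intro limsup_ereal_eqI[of _ _ r "\<lambda>k. - g k"]) (auto intro: tendsto_minus)
  then have "- liminf (\<lambda>n. ereal (f n)) = - ereal L"
    using ereal_Limsup_uminus[of sequentially "\<lambda>n. ereal (f n)"] by simp
  then show ?thesis by (simp only: ereal_uminus_eq_iff)
qed

theorem theorem6:
  assumes "infinite (UNIV :: 'a set)"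
  shows "rel_interval (nai :: 'a alg) maj = {ereal (- 1 / 4) .. ereal (1 / 4)}
    \<and> Min_rel (nai :: 'a alg) maj = ereal (- 1 / 4)
    \<and> Max_rel (nai :: 'a alg) maj = ereal (1 / 4)"
proof -
  \<comment> \<open>The examples have even length, and \<open>Suc k\<close> provides the positive
    number of pairs they require.\<close>
  have even: "strict_mono (\<lambda>k. 2 * Suc k)"
    by (simp add: strict_mono_def)
  have "(\<lambda>k. 1 / 4 * (1 / real k)) \<longlonglongrightarrow> 1 / 4 * 0"
    by (intro tendsto_mult tendsto_const lim_1_over_n)
  then have "(\<lambda>k. 1 / (4 * real k)) \<longlonglongrightarrow> 0" by simp
  then have null: "(\<lambda>k. 1 / (4 * real (Suc k))) \<longlonglongrightarrow> 0" by (rule LIMSEQ_Suc)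
  have "(\<lambda>k. - 1 / 4 + 1 / (4 * real (Suc k))) \<longlonglongrightarrow> - 1 / 4"
    using tendsto_add[OF tendsto_const null, of "- 1 / 4"] by (simp del: of_nat_Suc)
  then have Min: "Min_rel (nai :: 'a alg) maj = ereal (- 1 / 4)"
    unfolding Min_rel_def
    using Min_nai_maj_lower Min_nai_maj_upper[OF assms zero_less_Suc]
    by (intro liminf_ereal_eqI[where r = "\<lambda>k. 2 * Suc k"] even)
  have "(\<lambda>k. 1 / 4 - 1 / (4 * real (Suc k))) \<longlonglongrightarrow> 1 / 4"
    using tendsto_diff[OF tendsto_const null, of "1 / 4"] by (simp del: of_nat_Suc)
  then have Max: "Max_rel (nai :: 'a alg) maj = ereal (1 / 4)"
    unfolding Max_rel_def
    using Max_nai_maj_upper Max_nai_maj_lower[OF assms zero_less_Suc]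
    by (intro limsup_ereal_eqI[where r = "\<lambda>k. 2 * Suc k"] even)
  show ?thesis
    using Min Max by (simp add: rel_interval_def)
qed

end
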